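(* Let $n\geq 3$ be an integer, let $W$ be a $2$-basic landmark system for the generalized Hamming graph $HG(n,n,n;3)$, and let $u=(n+1,n+1,n+1)$. Then the triple-looped landmark system $W\cup\{u\}$ resolves $HG(n+1,n+1,n+1;3)$ if and only if the edge-colored landmark graph $\mathcal{G}(W)$ contains none of the following subgraphs: (1) a $4$-cycle that contains all three colors of edges; (2) a $6$-cycle with opposite edges of the same color (that is, each of its three pairs of opposite edges consists of two edges of the same color); (3) a rainbow triangle (a $3$-cycle whose edges have three different colors).
   Context: Write $[m]=\{1,2,\ldots,m\}$. For $m\geq 3$, the generalized Hamming graph $HG(m,m,m;3)$ is the simple graph with vertex set $[m]^3$ in which two vertices $(x_1,x_2,x_3)$ and $(y_1,y_2,y_3)$ are adjacent if and only if $x_i\neq y_i$ for $i=1,2,3$; it is connected. For a finite connected graph $G$ with vertex set $V$ and graph distance $d$, a subset $S\subseteq V$ is a resolving set for $G$ (or $S$ resolves $G$) if for every pair of distinct vertices $x,y\in V-S$ there exists $w\in S$ such that $d(x,w)\neq d(y,w)$. For $W\subseteq [n]^3$, $1\leq i\leq 3$ and $a\in[n]$, let $W_{i,a}=\{(x_1,x_2,x_3)\in W\mid x_i=a\}$. The landmark graph $\mathcal{G}(W)$ is the edge-colored hypergraph with vertex set $W$ whose hyperedges are the nonempty sets $W_{i,a}$, with $W_{i,a}$ assigned color $i\in\{1,2,3\}$. A set $W\subseteq[n]^3$ is a $2$-basic landmark system for $HG(n,n,n;3)$ if (i) $|W_{i,a}|=2$ for all $1\leq i\leq 3$ and $a\in[n]$;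 and (ii) $|W_{i,a}\cap W_{j,b}|\leq 1$ for all $1\leq i<j\leq 3$ and $a,b\in[n]$. In this case $\mathcal{G}(W)$ is a simple $3$-regular graph, properly edge-colored with three colors, with $n$ edges of each color. Subgraphs are not required to be induced. With $u=(n+1,n+1,n+1)$, the set $W\cup\{u\}\subseteq[n+1]^3$ is called the triple-looped landmark system for $HG(n+1,n+1,n+1;3)$ extending $W$. *)

theory Defs
  imports "Graph_Theory.Graph_Theory"
begin

section \<open>Resolving sets\<close>

text \<open>Graph distance is the library's shortest-path cost with every arc of cost one.\<close>

definition graph_dist :: "('a, 'b) pre_digraph \<Rightarrow> 'a \<Rightarrow> 'a \<Rightarrow> ereal" where
  "graph_dist G x y = wf_digraph.\<mu> G (\<lambda>_. 1) x y"

definition resolving_set :: "('a, 'b) pre_digraph \<Rightarrow> 'a set \<Rightarrow> bool" where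
  "resolving_set G S \<longleftrightarrow> S \<subseteq> verts G \<and>
     (\<forall>x \<in> verts G - S. \<forall>y \<in> verts G - S.
        x \<noteq> y \<longrightarrow> (\<exists>w \<in> S. graph_dist G x w \<noteq> graph_dist G y w))"

section \<open>Generalized Hamming graphs\<close>

type_synonym point = "nat \<times> nat \<times> nat"

text \<open>Only the indices 1, 2, 3 are meaningful.\<close>

definition coord :: "nat \<Rightarrow> point \<Rightarrow> nat" where
  "coord i x = (case x of (x1, x2, x3) \<Rightarrow> if i = 1 then x1 else if i = 2 then x2 else x3)"

definition cube :: "nat \<Rightarrow> point set" where
  "cube m = {1..m} \<times> {1..m} \<times> {1..m}"

text \<open>\<open>HG m\<close> is $HG(m,m,m;3)$, as a symmetric loop-free digraph without parallel arcs.\<close>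

definition HG :: "nat \<Rightarrow> point pair_pre_digraph" where
  "HG m = \<lparr> pverts = cube m,
            parcs = {(x, y) \<in> cube m \<times> cube m. \<forall>i \<in> {1..3}. coord i x \<noteq> coord i y} \<rparr>"

lemma HG_pair_graph: "pair_graph (HG m)"
proof
  show "finite (pverts (HG m))"
    by (simp add: HG_def cube_def)
  have "parcs (HG m) \<subseteq> pverts (HG m) \<times> pverts (HG m)"
    by (auto simp: HG_def)
  then show "finite (parcs (HG m))"
    by (rule finite_subset) (simp add: HG_def cube_def)
  show "symmetric (HG m)"
    unfolding symmetric_def by (rule symI) (simp add: HG_def, metis)
qed (force simp: HG_def)+

section \<open>Landmark systems and landmark graphs\<close>

text \<open>A hyperedge carries its color, so one vertex set may occur with several colors.\<close>

record ('v, 'c) colored_hypergraph =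
  hverts :: "'v set"
  hedges :: "('v set \<times> 'c) set"

definition coord_slice :: "point set \<Rightarrow> nat \<Rightarrow> nat \<Rightarrow> point set" where
  "coord_slice W i a = {x \<in> W. coord i x = a}"

definition landmark_graph :: "nat \<Rightarrow> point set \<Rightarrow> (point, nat) colored_hypergraph" where
  "landmark_graph n W =
     \<lparr> hverts = W,
       hedges = {(coord_slice W i a, i) | i a.
                   i \<in> {1..3} \<and> a \<in> {1..n} \<and> coord_slice W i a \<noteq> {}} \<rparr>"

definition two_basic_landmark_system :: "nat \<Rightarrow> point set \<Rightarrow> bool" where
  "two_basic_landmark_system n W \<longleftrightarrow>
     W \<subseteq> cube n \<and>
     (\<forall>i \<in> {1..3}. \<forall>a \<in> {1..n}. card (coord_slice W i a) = 2) \<and>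
     (\<forall>i \<in> {1..3}. \<forall>j \<in> {1..3}. i < j \<longrightarrow>
        (\<forall>a \<in> {1..n}. \<forall>b \<in> {1..n}. card (coord_slice W i a \<inter> coord_slice W j b) \<le> 1))"

text \<open>
  \<open>colored_cycle H vs cs\<close>: the distinct vertices \<open>vs\<close>, in cyclic order, span a (not necessarily
  induced) cycle of \<open>H\<close>, and \<open>cs ! k\<close> is the color of the edge from \<open>vs ! k\<close> to its successor.
\<close>

definition colored_cycle ::
    "('v, 'c) colored_hypergraph \<Rightarrow> 'v list \<Rightarrow> 'c list \<Rightarrow> bool" where
  "colored_cycle H vs cs \<longleftrightarrow>
     length vs \<ge> 3 \<and> length cs = length vs \<and> distinct vs \<and> set vs \<subseteq> hverts H \<and>
     (\<forall>k < length vs. ({vs ! k, vs ! (Suc k mod length vs)}, cs ! k) \<in> hedges H)"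

definition has_three_colored_4_cycle :: "('v, nat) colored_hypergraph \<Rightarrow> bool" where
  "has_three_colored_4_cycle H \<longleftrightarrow>
     (\<exists>vs cs. colored_cycle H vs cs \<and> length vs = 4 \<and> set cs = {1, 2, 3})"

definition has_opposite_colored_6_cycle :: "('v, 'c) colored_hypergraph \<Rightarrow> bool" where
  "has_opposite_colored_6_cycle H \<longleftrightarrow>
     (\<exists>vs cs. colored_cycle H vs cs \<and> length vs = 6 \<and> (\<forall>k < 3. cs ! k = cs ! (k + 3)))"

definition has_rainbow_triangle :: "('v, 'c) colored_hypergraph \<Rightarrow> bool" where
  "has_rainbow_triangle H \<longleftrightarrow>
     (\<exists>vs cs. colored_cycle H vs cs \<and> length vs = 3 \<and> distinct cs)"

end

theory Submission
  imports Defs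
begin

text \<open>
  Distinct vertices of $HG(m,m,m;3)$ with $m \<ge> 3$ are at distance 2 or 1 according to whether they
  agree in some coordinate or not. So a landmark only tells whether it agrees with a vertex
  somewhere, and a set resolves the graph exactly if non-landmarks are determined by the set of
  landmarks they agree with.

  Now translate vertices into edges of the landmark graph. A coordinate $x_i \<le> n$ is the edge
  $W_{i,x_i}$ of color $i$, while $x_i = n+1$ is the absence of an edge of that color. A vertex $x$ thus
  becomes a \<open>selection\<close>, a set of edges with at most one of each color, and this is a bijection.
  The landmarks in \<open>W\<close> that $x$ agrees with are the vertices covered by the selection; the extra
  landmark $u$ agrees with $x$ exactly if some color is missing. The landmarks themselves are the
  stars of three edges through a common vertex, and the empty selection. Hence resolving fails
  exactly if two different selections are \<open>confusable\<close>: neither is a landmark, they cover the same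
  vertices, and both or neither of them use all three colors.

  It remains to see that confusable selections come from the three forbidden subgraphs. Two edges
  of the same color are equal or disjoint, and edges of different colors never coincide.
  If a color is missing, each selection has one or two edges, and two different ones with the same
  cover contain a triangle between them (\<open>two_edges_same_cover\<close>). If all three colors are present, one compares the
  selections color by color. An edge that is replaced is disjoint from its replacement, so it must be
  covered by the edges of the other two colors in the other selection, meeting each in exactly one
  vertex
  (\<open>edge_straddles\<close>). If one edge is replaced, this gives a three-colored 4-cycle; if two are, the
  first selection is a star, hence a landmark; if all three are, the six edges form a 6-cycle with
  opposite edges of the same color. Conversely the edges of each forbidden subgraph provide two
  confusable selections.
\<close>

section \<open>Points and distances in the Hamming graph\<close>

lemma ball_1_3: "(\<forall>i \<in> {1..3::nat}. P i) \<longleftrightarrow> P 1 \<and> P 2 \<and> P 3"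
proof -
  have "{1..3::nat} = {1, 2, 3}" by auto
  then show ?thesis by simp
qed

lemma coord_tuple: "i \<in> {1..3} \<Longrightarrow> coord i (f 1, f 2, f 3) = f i"
  using ball_1_3[of "\<lambda>i. coord i (f 1, f 2, f 3) = f i"] by (simp add: coord_def)

lemma point_eq_iff: "x = y \<longleftrightarrow> (\<forall>i \<in> {1..3}. coord i x = coord i y)"
  unfolding ball_1_3 by (cases x; cases y) (simp add: coord_def)

lemma cube_iff: "x \<in> cube m \<longleftrightarrow> (\<forall>i \<in> {1..3}. coord i x \<in> {1..m})"
  unfolding ball_1_3 by (cases x) (auto simp: coord_def cube_def)

definition share_coord :: "point \<Rightarrow> point \<Rightarrow> bool" where
  "share_coord x w \<longleftrightarrow> (\<exists>i \<in> {1..3}. coord i x = coord i w)"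

text \<open>
  Two vertices agreeing in a coordinate have a common neighbour, because each coordinate has a
  third value to choose. This is where \<open>m \<ge> 3\<close> enters.
\<close>

lemma ex_avoiding_both:
  assumes "m \<ge> 3"
  shows "\<exists>z \<in> cube m. \<not> share_coord x z \<and> \<not> share_coord z w"
proof -
  have "\<exists>c \<in> {1..m}. c \<noteq> a \<and> c \<noteq> b" for a b :: nat
  proof -
    have "card ({1..m} - {a, b}) \<ge> card {1..m} - card {a, b}"
      by (rule diff_card_le_card_Diff) simp
    moreover have "card {a, b} \<le> 2"
      by (simp add: card_insert_if)
    ultimately have "card ({1..m} - {a, b}) > 0"
      using assms by simp
    then show ?thesis
      by (metis Diff_iff card_gt_0_iff equals0I insertCI)
  qed
  then have "\<forall>i. \<exists>c. c \<in> {1..m} \<and> c \<noteq> coord i x \<and> c \<noteq> coord i w"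
    by blast
  then obtain f where f: "\<And>i. f i \<in> {1..m} \<and> f i \<noteq> coord i x \<and> f i \<noteq> coord i w"
    by (elim choice[THEN exE]) blast
  obtain z where z: "\<And>i. i \<in> {1..3} \<Longrightarrow> coord i z = f i"
    using coord_tuple[of _ f] by blast
  have "z \<in> cube m"
    using f z by (simp only: cube_iff) simp
  moreover have "\<not> share_coord x z" "\<not> share_coord z w"
    unfolding share_coord_def using f z by (metis, metis)
  ultimately show ?thesis
    by blast
qed

lemma graph_dist_HG:
  assumes m: "m \<ge> 3" and x: "x \<in> cube m" and w: "w \<in> cube m" and "x \<noteq> w"
  shows "graph_dist (with_proj (HG m)) x w = (if share_coord x w then 2 else 1)"
proof -
  interpret pair_graph "HG m"
    by (rule HG_pair_graph)
  have arc: "(y, z) \<in> parcs (HG m) \<longleftrightarrow> y \<in> cube m \<and> z \<in> cube m \<and> \<not> share_coord y z" for y z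
    by (auto simp: HG_def share_coord_def)
  have verts: "pverts (HG m) = cube m"
    by (simp add: HG_def)
  have cost: "awalk_cost (\<lambda>_. 1) p = real (length p)" for p
    by (induction p) simp_all
  have dist: "graph_dist (with_proj (HG m)) x w = (INF p \<in> {p. awalk x p w}. ereal (real (length p)))"
    by (simp add: graph_dist_def \<mu>_def cost)
  have nonempty: "p \<noteq> []" if "awalk x p w" for p
    using that \<open>x \<noteq> w\<close> by (auto simp: awalk_Nil_iff)
  have dist_eqI: "graph_dist (with_proj (HG m)) x w = ereal (real (length q))"
    if q: "awalk x q w" and shortest: "\<And>p. awalk x p w \<Longrightarrow> length q \<le> length p" for q
    unfolding dist
  proof (rule antisym)
    show "(INF p \<in> {p. awalk x p w}. ereal (real (length p))) \<le> ereal (real (length q))"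
      using q by (intro INF_lower) simp
    show "ereal (real (length q)) \<le> (INF p \<in> {p. awalk x p w}. ereal (real (length p)))"
      using shortest by (intro INF_greatest) simp
  qed
  show ?thesis
  proof (cases "share_coord x w")
    case False
    have "awalk x [(x, w)] w"
      using False x w arc verts by (simp add: awalk_simps)
    moreover have "length [(x, w)] \<le> length p" if "awalk x p w" for p
      using nonempty[OF that] by (cases p) simp_all
    ultimately have "graph_dist (with_proj (HG m)) x w = ereal (real (length [(x, w)]))"
      by (rule dist_eqI)
    then show ?thesis
      using False by simp
  next
    case True
    obtain z where "z \<in> cube m" "\<not> share_coord x z" "\<not> share_coord z w"
      using ex_avoiding_both[OF m] by blast
    then have "awalk x [(x, z), (z, w)] w"
      using x w arc verts by (simp add: awalk_simps)
    moreover have "length [(x, z), (z, w)] \<le> length p" if p: "awalk x p w" for p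
    proof -
      have "length p \<noteq> 1"
      proof
        assume "length p = 1"
        then obtain e where "p = [e]"
          by (auto simp: length_Suc_conv)
        then have "(x, w) \<in> parcs (HG m)"
          using p by (cases e) (auto simp: awalk_simps)
        then show False
          using True arc by blast
      qed
      then show ?thesis
        using nonempty[OF p] by (cases p; cases "tl p") auto
    qed
    ultimately have "graph_dist (with_proj (HG m)) x w = ereal (real (length [(x, z), (z, w)]))"
      by (rule dist_eqI)
    then show ?thesis
      using True by simp
  qed
qed

text \<open>
  Pairs of vertices outside \<open>S\<close> never have distance 0 to a landmark, so only the distances 1 and 2
  have to be told apart.
\<close>

lemma resolving_set_HG_iff:
  assumes "m \<ge> 3" and S: "S \<subseteq> cube m"
  shows "resolving_set (with_proj (HG m)) S \<longleftrightarrow>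
    (\<forall>x \<in> cube m - S. \<forall>y \<in> cube m - S.
       {w \<in> S. share_coord x w} = {w \<in> S. share_coord y w} \<longrightarrow> x = y)"
proof -
  have verts: "verts (with_proj (HG m)) = cube m"
    by (simp add: HG_def)
  have dist_iff: "graph_dist (with_proj (HG m)) x w \<noteq> graph_dist (with_proj (HG m)) y w \<longleftrightarrow>
      share_coord x w \<noteq> share_coord y w"
    if "x \<in> cube m - S" "y \<in> cube m - S" "w \<in> S" for x y w
  proof -
    have "w \<in> cube m" "x \<noteq> w" "y \<noteq> w"
      using that S by auto
    then show ?thesis
      using that by (simp add: graph_dist_HG[OF \<open>m \<ge> 3\<close>])
  qed
  have "(\<exists>w \<in> S. graph_dist (with_proj (HG m)) x w \<noteq> graph_dist (with_proj (HG m)) y w) \<longleftrightarrow>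
      {w \<in> S. share_coord x w} \<noteq> {w \<in> S. share_coord y w}"
    if "x \<in> cube m - S" "y \<in> cube m - S" for x y
  proof -
    have "(\<exists>w \<in> S. graph_dist (with_proj (HG m)) x w \<noteq> graph_dist (with_proj (HG m)) y w) \<longleftrightarrow>
        (\<exists>w \<in> S. share_coord x w \<noteq> share_coord y w)"
      by (intro bex_cong refl dist_iff that)
    also have "\<dots> \<longleftrightarrow> {w \<in> S. share_coord x w} \<noteq> {w \<in> S. share_coord y w}"
      by blast
    finally show ?thesis .
  qed
  then have "resolving_set (with_proj (HG m)) S \<longleftrightarrow> S \<subseteq> cube m \<and>
      (\<forall>x \<in> cube m - S. \<forall>y \<in> cube m - S.
         x \<noteq> y \<longrightarrow> {w \<in> S. share_coord x w} \<noteq> {w \<in> S. share_coord y w})"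
    unfolding resolving_set_def verts by (intro conj_cong ball_cong imp_cong refl)
  then show ?thesis
    using S by blast
qed

section \<open>Selections of edges in a properly colored simple graph\<close>

text \<open>
  Each of these is stated for the numeral bound and for its successor form: simplifying the length
  of an explicit list produces the latter.
\<close>

lemma all_less_3:
  "(\<forall>k < 3. P k) \<longleftrightarrow> P 0 \<and> P 1 \<and> P (2::nat)"
  "(\<forall>k < Suc (Suc (Suc 0)). P k) \<longleftrightarrow> P 0 \<and> P 1 \<and> P (2::nat)"
  by (simp_all add: eval_nat_numeral All_less_Suc2)

lemma all_less_4:
  "(\<forall>k < 4. P k) \<longleftrightarrow> P 0 \<and> P 1 \<and> P 2 \<and> P (3::nat)"
  "(\<forall>k < Suc (Suc (Suc (Suc 0))). P k) \<longleftrightarrow> P 0 \<and> P 1 \<and> P 2 \<and> P (3::nat)"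
  by (simp_all add: eval_nat_numeral All_less_Suc2)

lemma all_less_6:
  "(\<forall>k < 6. P k) \<longleftrightarrow> P 0 \<and> P 1 \<and> P 2 \<and> P 3 \<and> P 4 \<and> P (5::nat)"
  "(\<forall>k < Suc (Suc (Suc (Suc (Suc (Suc 0))))). P k) \<longleftrightarrow> P 0 \<and> P 1 \<and> P 2 \<and> P 3 \<and> P 4 \<and> P (5::nat)"
  by (simp_all add: eval_nat_numeral All_less_Suc2)

text \<open>
  What the argument needs of a landmark graph: it is a simple graph with three colors in which edges
  of the same color form a matching.
\<close>

locale properly_colored_graph =
  fixes H :: "('v, nat) colored_hypergraph"
  assumes edge_card: "(A, i) \<in> hedges H \<Longrightarrow> card A = 2"
    and edge_subset: "(A, i) \<in> hedges H \<Longrightarrow> A \<subseteq> hverts H"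
    and edge_color: "(A, i) \<in> hedges H \<Longrightarrow> i \<in> {1..3}"
    and proper: "(A, i) \<in> hedges H \<Longrightarrow> (B, i) \<in> hedges H \<Longrightarrow> A \<noteq> B \<Longrightarrow> A \<inter> B = {}"
    and simple: "(A, i) \<in> hedges H \<Longrightarrow> (A, j) \<in> hedges H \<Longrightarrow> i = j"
begin

text \<open>An edge set with at most one edge of each color: the translation of a vertex of the cube.\<close>

definition selection :: "('v set \<times> nat) set \<Rightarrow> bool" where
  "selection X \<longleftrightarrow> X \<subseteq> hedges H \<and> inj_on snd X"

definition complete :: "('v set \<times> nat) set \<Rightarrow> bool" where
  "complete X \<longleftrightarrow> snd ` X = {1..3}"

text \<open>
  The empty selection stands for the extra landmark, which is not a vertex of the graph, and a star
  of three differently colored edges for the landmark at its centre.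
\<close>

definition landmark_selection :: "('v set \<times> nat) set \<Rightarrow> bool" where
  "landmark_selection X \<longleftrightarrow> X = {} \<or> complete X \<and> \<Inter> (fst ` X) \<noteq> {}"

text \<open>
  Two distinct vertices that no landmark separates: the common cover accounts for the landmarks in
  the graph, the agreement in completeness for the extra one.
\<close>

definition confusable :: "('v set \<times> nat) set \<Rightarrow> ('v set \<times> nat) set \<Rightarrow> bool" where
  "confusable X Y \<longleftrightarrow> selection X \<and> selection Y \<and> X \<noteq> Y \<and>
     \<not> landmark_selection X \<and> \<not> landmark_selection Y \<and>
     \<Union> (fst ` X) = \<Union> (fst ` Y) \<and> (complete X \<longleftrightarrow> complete Y)"

subsection \<open>Building and reading off cycles\<close>

lemma adjacent_edges_distinct_colors:
  assumes "({p, q}, i) \<in> hedges H" "({q, r}, j) \<in> hedges H" "p \<noteq> r"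
  shows "i \<noteq> j"
  using assms proper[of "{p, q}" i "{q, r}"] by (auto simp: doubleton_eq_iff)

lemma distinct_edge_colors:
  assumes "(A, a) \<in> hedges H" "(B, b) \<in> hedges H" "(C, c) \<in> hedges H" "distinct [a, b, c]"
  shows "{a, b, c} = {1..3}"
  using assms assms(1-3)[THEN edge_color] by (intro card_subset_eq) auto

text \<open>Edges of a triangle are pairwise adjacent, so every triangle is a rainbow triangle.\<close>

lemma rainbow_triangle_iff:
  "has_rainbow_triangle H \<longleftrightarrow>
     (\<exists>p q r a b c. distinct [p, q, r] \<and>
        ({p, q}, a) \<in> hedges H \<and> ({q, r}, b) \<in> hedges H \<and> ({r, p}, c) \<in> hedges H)"
    (is "_ \<longleftrightarrow> ?R")
proof
  assume "has_rainbow_triangle H"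
  then obtain vs cs where *: "colored_cycle H vs cs" "length vs = 3"
    by (auto simp: has_rainbow_triangle_def)
  then obtain p q r where vs: "vs = [p, q, r]"
    by (auto simp: eval_nat_numeral length_Suc_conv)
  show ?R
    using * unfolding colored_cycle_def vs by (auto simp: all_less_3)
next
  assume ?R
  then obtain p q r a b c where *: "distinct [p, q, r]"
    "({p, q}, a) \<in> hedges H" "({q, r}, b) \<in> hedges H" "({r, p}, c) \<in> hedges H"
    by blast
  have "a \<noteq> b" "b \<noteq> c" "c \<noteq> a"
    using * adjacent_edges_distinct_colors by (metis distinct_length_2_or_more)+
  moreover have "colored_cycle H [p, q, r] [a, b, c]"
    using * edge_subset[OF *(2)] edge_subset[OF *(3)]
    by (auto simp: colored_cycle_def all_less_3)
  ultimately show "has_rainbow_triangle H"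
    unfolding has_rainbow_triangle_def by (intro exI[of _ "[p, q, r]"] exI[of _ "[a, b, c]"]) auto
qed

text \<open>
  A 4-cycle with all three colors has, up to rotation, two opposite edges of one color \<open>a\<close>, and two
  opposite edges of the other two colors.
\<close>

lemma three_colored_4_cycle_iff:
  "has_three_colored_4_cycle H \<longleftrightarrow>
     (\<exists>p q r s a b c. distinct [p, q, r, s] \<and> distinct [a, b, c] \<and>
        ({p, q}, a) \<in> hedges H \<and> ({q, r}, b) \<in> hedges H \<and>
        ({r, s}, a) \<in> hedges H \<and> ({s, p}, c) \<in> hedges H)"
    (is "_ \<longleftrightarrow> ?R")
proof
  assume "has_three_colored_4_cycle H"
  then obtain vs cs where *: "colored_cycle H vs cs" "length vs = 4" "length cs = 4"
      and colors: "set cs = {1, 2, 3}"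
    by (auto simp: has_three_colored_4_cycle_def colored_cycle_def)
  then obtain p q r s a b d c where vs: "vs = [p, q, r, s]" and cs: "cs = [a, b, d, c]"
    by (auto simp: eval_nat_numeral length_Suc_conv)
  have dist: "distinct [p, q, r, s]"
    and e: "({p, q}, a) \<in> hedges H" "({q, r}, b) \<in> hedges H"
      "({r, s}, d) \<in> hedges H" "({s, p}, c) \<in> hedges H"
    using *(1) unfolding colored_cycle_def vs cs by (auto simp: all_less_4)
  have adj: "a \<noteq> b" "b \<noteq> d" "d \<noteq> c" "c \<noteq> a"
    using dist e adjacent_edges_distinct_colors by (metis distinct_length_2_or_more)+
  have set: "{a, b, d, c} = {1, 2, 3}"
    using colors cs by simp
  \<comment> \<open>Four edges carry only three colors, and the repeated color must sit on opposite edges.\<close>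
  have "a = d \<or> b = c"
  proof (rule ccontr)
    assume "\<not> (a = d \<or> b = c)"
    then have "card {a, b, d, c} = 4"
      using adj by auto
    then show False
      unfolding set by simp
  qed
  then show ?R
  proof
    assume "a = d"
    moreover have "b \<noteq> c"
    proof
      assume "b = c"
      with \<open>a = d\<close> set have "{a, b} = {1, 2, 3}" by auto
      then have "card {a, b} = 3" by simp
      then show False by (simp add: card_insert_if split: if_splits)
    qed
    ultimately have "distinct [p, q, r, s] \<and> distinct [a, b, c] \<and>
        ({p, q}, a) \<in> hedges H \<and> ({q, r}, b) \<in> hedges H \<and>
        ({r, s}, a) \<in> hedges H \<and> ({s, p}, c) \<in> hedges H"
      using dist e adj by auto
    then show ?R by blast
  next
    assume "b = c"
    moreover have "a \<noteq> d"
    proof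
      assume "a = d"
      with \<open>b = c\<close> set have "{a, b} = {1, 2, 3}" by auto
      then have "card {a, b} = 3" by simp
      then show False by (simp add: card_insert_if split: if_splits)
    qed
    ultimately have "distinct [q, r, s, p] \<and> distinct [b, d, a] \<and>
        ({q, r}, b) \<in> hedges H \<and> ({r, s}, d) \<in> hedges H \<and>
        ({s, p}, b) \<in> hedges H \<and> ({p, q}, a) \<in> hedges H"
      using dist e adj by auto
    then show ?R by blast
  qed
next
  assume ?R
  then obtain p q r s a b c where dist: "distinct [p, q, r, s]" "distinct [a, b, c]"
    and e: "({p, q}, a) \<in> hedges H" "({q, r}, b) \<in> hedges H"
      "({r, s}, a) \<in> hedges H" "({s, p}, c) \<in> hedges H"
    by blast
  have "set [a, b, a, c] = {a, b, c}"
    by auto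
  also have "\<dots> = {1..3}"
    using distinct_edge_colors e dist by blast
  also have "\<dots> = {1, 2, 3}"
    by auto
  finally have "set [a, b, a, c] = {1, 2, 3}" .
  moreover have "colored_cycle H [p, q, r, s] [a, b, a, c]"
    using dist e edge_subset[OF e(1)] edge_subset[OF e(3)]
    by (auto simp: colored_cycle_def all_less_4)
  ultimately show "has_three_colored_4_cycle H"
    unfolding has_three_colored_4_cycle_def
    by (intro exI[of _ "[p, q, r, s]"] exI[of _ "[a, b, a, c]"]) auto
qed

text \<open>
  In an opposite-colored 6-cycle any two of the three colors occur on adjacent edges, so the colors
  are automatically distinct.
\<close>

lemma opposite_colored_6_cycle_iff:
  "has_opposite_colored_6_cycle H \<longleftrightarrow>
     (\<exists>p q r s t u a b c. distinct [p, q, r, s, t, u] \<and> distinct [a, b, c] \<and>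
        ({p, q}, a) \<in> hedges H \<and> ({q, r}, b) \<in> hedges H \<and> ({r, s}, c) \<in> hedges H \<and>
        ({s, t}, a) \<in> hedges H \<and> ({t, u}, b) \<in> hedges H \<and> ({u, p}, c) \<in> hedges H)"
    (is "_ \<longleftrightarrow> ?R")
proof
  assume "has_opposite_colored_6_cycle H"
  then obtain vs cs where *: "colored_cycle H vs cs" "length vs = 6" "length cs = 6"
      and opp: "\<forall>k < 3. cs ! k = cs ! (k + 3)"
    by (auto simp: has_opposite_colored_6_cycle_def colored_cycle_def)
  then obtain p q r s t u a b c a' b' c'
    where vs: "vs = [p, q, r, s, t, u]" and cs: "cs = [a, b, c, a', b', c']"
    by (auto simp: eval_nat_numeral length_Suc_conv)
  have eq: "a' = a" "b' = b" "c' = c"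
    using opp unfolding cs by (auto simp: all_less_3)
  have dist: "distinct [p, q, r, s, t, u]"
    and e: "({p, q}, a) \<in> hedges H" "({q, r}, b) \<in> hedges H" "({r, s}, c) \<in> hedges H"
      "({s, t}, a) \<in> hedges H" "({t, u}, b) \<in> hedges H" "({u, p}, c) \<in> hedges H"
    using *(1) unfolding colored_cycle_def vs cs eq by (auto simp: all_less_6)
  have "a \<noteq> b" "b \<noteq> c" "c \<noteq> a"
    using dist e adjacent_edges_distinct_colors by (metis distinct_length_2_or_more)+
  then have "distinct [a, b, c]"
    by auto
  with dist e show ?R
    by blast
next
  assume ?R
  then obtain p q r s t u a b c where dist: "distinct [p, q, r, s, t, u]"
    and e: "({p, q}, a) \<in> hedges H" "({q, r}, b) \<in> hedges H" "({r, s}, c) \<in> hedges H"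
      "({s, t}, a) \<in> hedges H" "({t, u}, b) \<in> hedges H" "({u, p}, c) \<in> hedges H"
    by blast
  have "colored_cycle H [p, q, r, s, t, u] [a, b, c, a, b, c]"
    using dist e edge_subset[OF e(1)] edge_subset[OF e(3)] edge_subset[OF e(5)]
    by (auto simp: colored_cycle_def all_less_6)
  then show "has_opposite_colored_6_cycle H"
    unfolding has_opposite_colored_6_cycle_def
    by (intro exI[of _ "[p, q, r, s, t, u]"] exI[of _ "[a, b, c, a, b, c]"]) (auto simp: all_less_3)
qed

subsection \<open>Two selections with the same cover\<close>

lemma edge_subset_edge:
  assumes "(A, i) \<in> hedges H" "(B, j) \<in> hedges H" "A \<subseteq> B"
  shows "i = j" "A = B"
proof -
  show "A = B"
    using assms edge_card card_subset_eq by (metis card.infinite zero_neq_numeral)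
  then show "i = j"
    using assms simple by blast
qed

text \<open>
  An edge has two vertices and is contained in neither of the differently colored edges that cover
  it, so it takes one vertex from each, outside the other.
\<close>

lemma edge_straddles:
  assumes A: "(A, i) \<in> hedges H" and B: "(B, j) \<in> hedges H" and C: "(C, k) \<in> hedges H"
    and "i \<noteq> j" "i \<noteq> k" and sub: "A \<subseteq> B \<union> C"
  obtains p q where "A = {p, q}" "p \<in> B" "p \<notin> C" "q \<in> C" "q \<notin> B"
proof -
  have "\<not> A \<subseteq> B" "\<not> A \<subseteq> C"
    using edge_subset_edge A B C \<open>i \<noteq> j\<close> \<open>i \<noteq> k\<close> by blast+
  then obtain p q where pq: "p \<in> A" "p \<notin> C" "q \<in> A" "q \<notin> B"
    by blast
  obtain v w where "A = {v, w}"
    using edge_card[OF A] by (auto simp: card_2_iff)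
  then have "A = {p, q}"
    using pq sub by auto
  with pq sub that show thesis
    by blast
qed

text \<open>
  If each pair has two colors, then \<open>{a, b}\<close> and \<open>{c, d}\<close> share one of the three colors. Its two edges must agree, since otherwise one of
  them would be covered by an edge of another color. If the remaining edges differ, then each of them
  meets the common edge in one vertex, and the two meet in the vertex that the common edge misses:
  a triangle. Equal colors are admitted so that a pair may also stand for a single edge.
\<close>

lemma two_edges_same_cover:
  assumes no_triangle: "\<not> has_rainbow_triangle H"
    and A: "(A, a) \<in> hedges H" and B: "(B, b) \<in> hedges H"
    and C: "(C, c) \<in> hedges H" and D: "(D, d) \<in> hedges H"
    and ab: "a = b \<Longrightarrow> A = B" and cd: "c = d \<Longrightarrow> C = D"
    and cover: "A \<union> B = C \<union> D"
  shows "{(A, a), (B, b)} = {(C, c), (D, d)}"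
proof -
  have shared: "A' = C' \<and> a' = c' \<and> B' = D' \<and> b' = d'"
    if A': "(A', a') \<in> hedges H" and B': "(B', b') \<in> hedges H"
      and C': "(C', a') \<in> hedges H" and D': "(D', d') \<in> hedges H"
      and ne: "a' \<noteq> b'" "a' \<noteq> d'" and cover': "A' \<union> B' = C' \<union> D'" and "a' = c'"
    for A' B' C' D' a' b' c' d'
  proof -
    have "A' = C'"
    proof (rule ccontr)
      assume "A' \<noteq> C'"
      then have "C' \<subseteq> B'"
        using proper[OF A' C'] cover' by blast
      then show False
        using edge_subset_edge C' B' ne by blast
    qed
    moreover have "B' = D'"
    proof (rule ccontr)
      assume BD: "B' \<noteq> D'"
      obtain p q where pq: "B' = {p, q}" "p \<in> A'" "p \<notin> D'" "q \<in> D'" "q \<notin> A'"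
      proof (rule edge_straddles[OF B' A' D'])
        show "b' \<noteq> a'"
          using ne by simp
        show sub: "B' \<subseteq> A' \<union> D'"
          using cover' \<open>A' = C'\<close> by blast
        show "b' \<noteq> d'"
        proof
          assume "b' = d'"
          then have "B' \<subseteq> A'"
            using proper[OF B'] D' BD sub by blast
          then show False
            using edge_subset_edge[OF B' A'] ne by blast
        qed
      qed
      have "D' \<subseteq> A' \<union> B'"
        using cover' by blast
      obtain v w where D_vw: "D' = {v, w}" "v \<noteq> w"
        using edge_card[OF D'] by (auto simp: card_2_iff)
      obtain r where r: "D' = {q, r}" "r \<in> A'" "r \<noteq> p" "r \<noteq> q"
        using pq D_vw \<open>D' \<subseteq> A' \<union> B'\<close> by auto
      obtain v w where "A' = {v, w}"
        using edge_card[OF A'] by (auto simp: card_2_iff)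
      then have "A' = {r, p}"
        using pq r by auto
      then have "({p, q}, b') \<in> hedges H" "({q, r}, d') \<in> hedges H" "({r, p}, a') \<in> hedges H"
        using A' B' D' pq r by auto
      moreover have "distinct [p, q, r]"
        using pq r by auto
      ultimately show False
        using no_triangle unfolding rainbow_triangle_iff by blast
    qed
    ultimately show ?thesis
      using B' D' simple \<open>a' = c'\<close> by blast
  qed
  consider "a = b" | "c = d" | "a \<noteq> b" "c \<noteq> d"
    by blast
  then show ?thesis
  proof cases
    case 1
    then have "C \<subseteq> A" "D \<subseteq> A"
      using ab cover by blast+
    then show ?thesis
      using edge_subset_edge[OF C A] edge_subset_edge[OF D A] 1 ab by simp
  next
    case 2
    then have "A \<subseteq> C" "B \<subseteq> C"
      using cd cover by blast+
    then show ?thesis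
      using edge_subset_edge[OF A C] edge_subset_edge[OF B C] 2 cd by simp
  next
    case 3
    \<comment> \<open>Two pairs out of three colors overlap.\<close>
    have "a \<in> {1, 2, 3}" "b \<in> {1, 2, 3}" "c \<in> {1, 2, 3}" "d \<in> {1, 2, 3}"
      using A B C D edge_color by fastforce+
    then consider "a = c" | "a = d" | "b = c" | "b = d"
      using 3 by auto
    then show ?thesis
    proof cases
      case 1
      moreover have "A \<union> B = C \<union> D"
        using cover by blast
      ultimately show ?thesis
        using shared[of A a B b C D d c] A B C D \<open>a \<noteq> b\<close> \<open>c \<noteq> d\<close> by blast
    next
      case 2
      moreover have "A \<union> B = D \<union> C"
        using cover by blast
      ultimately show ?thesis
        using shared[of A a B b D C c d] A B C D \<open>a \<noteq> b\<close> \<open>c \<noteq> d\<close> by blast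
    next
      case 3
      moreover have "B \<union> A = C \<union> D"
        using cover by blast
      ultimately show ?thesis
        using shared[of B b A a C D d c] A B C D \<open>a \<noteq> b\<close> \<open>c \<noteq> d\<close> by blast
    next
      case 4
      moreover have "B \<union> A = D \<union> C"
        using cover by blast
      ultimately show ?thesis
        using shared[of B b A a D C c d] A B C D \<open>a \<noteq> b\<close> \<open>c \<noteq> d\<close> by blast
    qed
  qed
qed

text \<open>
  The disjoint edges \<open>C\<close> and \<open>F\<close> of color \<open>k\<close> both run between \<open>A\<close> and \<open>B\<close>, and close up to a 4-cycle
  with them.
\<close>

lemma cover_differing_in_one_edge:
  assumes A: "(A, i) \<in> hedges H" and B: "(B, j) \<in> hedges H"
    and C: "(C, k) \<in> hedges H" and F: "(F, k) \<in> hedges H"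
    and colors: "distinct [i, j, k]" and "C \<noteq> F"
    and cover: "A \<union> B \<union> C = A \<union> B \<union> F"
  shows "has_three_colored_4_cycle H"
proof -
  have neq: "i \<noteq> j" "j \<noteq> i" "i \<noteq> k" "k \<noteq> i" "j \<noteq> k" "k \<noteq> j"
    using colors by auto
  have disj: "C \<inter> F = {}"
    using proper[OF C F \<open>C \<noteq> F\<close>] .
  have sub: "C \<subseteq> A \<union> B" "F \<subseteq> A \<union> B"
    using cover disj by blast+
  obtain p s where C_eq: "C = {p, s}" "p \<in> A" "p \<notin> B" "s \<in> B" "s \<notin> A"
    using edge_straddles[OF C A B neq(4) neq(6) sub(1)] .
  obtain q r where F_eq: "F = {q, r}" "q \<in> A" "q \<notin> B" "r \<in> B" "r \<notin> A"
    using edge_straddles[OF F A B neq(4) neq(6) sub(2)] .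
  have ne: "p \<noteq> q" "r \<noteq> s"
    using disj C_eq F_eq by auto
  have "A = {p, q}" "B = {r, s}"
    using edge_card[OF A] edge_card[OF B] C_eq F_eq ne by (auto simp: card_2_iff)
  then have "({q, r}, k) \<in> hedges H" "({r, s}, j) \<in> hedges H" "({s, p}, k) \<in> hedges H"
      "({p, q}, i) \<in> hedges H"
    using A B C F C_eq F_eq by (auto simp: insert_commute)
  moreover have "distinct [q, r, s, p]" "distinct [k, j, i]"
    using C_eq F_eq ne colors by auto
  ultimately show ?thesis
    unfolding three_colored_4_cycle_iff by blast
qed

text \<open>
  The disjoint edges \<open>B\<close> and \<open>E\<close> leave \<open>A\<close> at different ends. \<open>C\<close> runs from the end of \<open>A\<close> that is not on
  \<open>E\<close> to the outer end of \<open>E\<close>, so it starts where \<open>B\<close> does. The configuration does occur, but the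
  selection \<open>A, B, C\<close> is then a landmark.
\<close>

lemma cover_differing_in_two_edges:
  assumes A: "(A, i) \<in> hedges H"
    and B: "(B, j) \<in> hedges H" and E: "(E, j) \<in> hedges H"
    and C: "(C, k) \<in> hedges H" and F: "(F, k) \<in> hedges H"
    and colors: "distinct [i, j, k]" and "B \<noteq> E" "C \<noteq> F"
    and cover: "A \<union> B \<union> C = A \<union> E \<union> F"
  shows "A \<inter> B \<inter> C \<noteq> {}"
proof -
  have neq: "i \<noteq> j" "j \<noteq> i" "i \<noteq> k" "k \<noteq> i" "j \<noteq> k" "k \<noteq> j"
    using colors by auto
  have disj: "B \<inter> E = {}" "C \<inter> F = {}"
    using proper[OF B E \<open>B \<noteq> E\<close>] proper[OF C F \<open>C \<noteq> F\<close>] .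
  have sub: "B \<subseteq> A \<union> F" "C \<subseteq> A \<union> E" "E \<subseteq> A \<union> C"
    using cover disj by blast+
  obtain p r where B_eq: "B = {p, r}" "p \<in> A" "p \<notin> F" "r \<in> F" "r \<notin> A"
    using edge_straddles[OF B A F neq(2) neq(5) sub(1)] .
  obtain q s where E_eq: "E = {q, s}" "q \<in> A" "q \<notin> C" "s \<in> C" "s \<notin> A"
    using edge_straddles[OF E A C neq(2) neq(5) sub(3)] .
  obtain t s' where C_eq: "C = {t, s'}" "t \<in> A" "t \<notin> E" "s' \<in> E" "s' \<notin> A"
    using edge_straddles[OF C A E neq(4) neq(6) sub(2)] .
  have "p \<noteq> q"
    using B_eq E_eq disj by auto
  then have "A = {p, q}"
    using edge_card[OF A] B_eq E_eq by (auto simp: card_2_iff)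
  then have "t = p"
    using C_eq E_eq by auto
  then show ?thesis
    using B_eq C_eq by auto
qed

text \<open>
  Each edge of one selection straddles the two edges of the other one with different colors. The
  intersection pattern is a hexagon \<open>A, F, B, D, C, E\<close>, in which edges of the same color face each
  other.
\<close>

lemma cover_differing_in_three_edges:
  assumes A: "(A, i) \<in> hedges H" and D: "(D, i) \<in> hedges H"
    and B: "(B, j) \<in> hedges H" and E: "(E, j) \<in> hedges H"
    and C: "(C, k) \<in> hedges H" and F: "(F, k) \<in> hedges H"
    and colors: "distinct [i, j, k]" and ne: "A \<noteq> D" "B \<noteq> E" "C \<noteq> F"
    and cover: "A \<union> B \<union> C = D \<union> E \<union> F"
  shows "has_opposite_colored_6_cycle H"
proof -
  have neq: "i \<noteq> j" "j \<noteq> i" "i \<noteq> k" "k \<noteq> i" "j \<noteq> k" "k \<noteq> j"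
    using colors by auto
  have disj: "A \<inter> D = {}" "B \<inter> E = {}" "C \<inter> F = {}"
    using proper[OF A D] proper[OF B E] proper[OF C F] ne by auto
  have sub: "A \<subseteq> E \<union> F" "B \<subseteq> F \<union> D" "C \<subseteq> D \<union> E"
      "D \<subseteq> B \<union> C" "E \<subseteq> C \<union> A" "F \<subseteq> A \<union> B"
    using cover disj by blast+
  obtain p q where A_eq: "A = {p, q}" "p \<in> E" "p \<notin> F" "q \<in> F" "q \<notin> E"
    using edge_straddles[OF A E F neq(1) neq(3) sub(1)] .
  obtain r s where B_eq: "B = {r, s}" "r \<in> F" "r \<notin> D" "s \<in> D" "s \<notin> F"
    using edge_straddles[OF B F D neq(5) neq(2) sub(2)] .
  obtain t u where C_eq: "C = {t, u}" "t \<in> D" "t \<notin> E" "u \<in> E" "u \<notin> D"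
    using edge_straddles[OF C D E neq(4) neq(6) sub(3)] .
  obtain s' t' where D_eq: "D = {s', t'}" "s' \<in> B" "s' \<notin> C" "t' \<in> C" "t' \<notin> B"
    using edge_straddles[OF D B C neq(1) neq(3) sub(4)] .
  obtain u' p' where E_eq: "E = {u', p'}" "u' \<in> C" "u' \<notin> A" "p' \<in> A" "p' \<notin> C"
    using edge_straddles[OF E C A neq(5) neq(2) sub(5)] .
  obtain q' r' where F_eq: "F = {q', r'}" "q' \<in> A" "q' \<notin> B" "r' \<in> B" "r' \<notin> A"
    using edge_straddles[OF F A B neq(4) neq(6) sub(6)] .
  have eqs: "s' = s" "t' = t" "u' = u" "p' = p" "q' = q" "r' = r"
    using A_eq B_eq C_eq D_eq E_eq F_eq by auto
  have "distinct [p, q, r, s, t, u]"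
    using A_eq B_eq C_eq D_eq E_eq F_eq eqs disj by auto
  moreover have "({p, q}, i) \<in> hedges H" "({q, r}, k) \<in> hedges H" "({r, s}, j) \<in> hedges H"
      "({s, t}, i) \<in> hedges H" "({t, u}, k) \<in> hedges H" "({u, p}, j) \<in> hedges H"
    using A B C D E F A_eq B_eq C_eq D_eq E_eq F_eq eqs by auto
  moreover have "distinct [i, k, j]"
    using colors by auto
  ultimately show ?thesis
    unfolding opposite_colored_6_cycle_iff by blast
qed

text \<open>A single edge is represented here by a pair of equal edges.\<close>

lemma incomplete_selectionE:
  assumes "selection X" "\<not> complete X" "X \<noteq> {}"
  obtains A a B b where "X = {(A, a), (B, b)}" "(A, a) \<in> hedges H" "(B, b) \<in> hedges H"
    "a = b \<Longrightarrow> A = B"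
proof -
  have colors: "snd ` X \<subset> {1..3}"
    using assms edge_color unfolding selection_def complete_def by fastforce
  have "finite (snd ` X)"
    using colors by (meson finite_atLeastAtMost finite_subset psubsetE)
  moreover have "card (snd ` X) < 3"
    using psubset_card_mono[OF _ colors] by simp
  moreover have "inj_on snd X"
    using assms by (simp add: selection_def)
  ultimately have "finite X" "card X < 3"
    using finite_imageD card_image by (force, fastforce)
  then have "card X = 1 \<or> card X = 2"
    using \<open>X \<noteq> {}\<close> by (cases "card X") auto
  then obtain e f where X: "X = {e, f}"
    by (metis card_1_singletonE card_2_iff insert_absorb2)
  show thesis
    using that[of "fst e" "snd e" "fst f" "snd f"] X assms(1) by (auto simp: selection_def inj_on_def)
qed

lemma complete_selectionE:
  assumes "selection X" "complete X"
  obtains A B C where "X = {(A, 1), (B, 2), (C, 3)}"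
    "(A, 1) \<in> hedges H" "(B, 2) \<in> hedges H" "(C, 3) \<in> hedges H"
proof -
  have colors: "snd ` X = {1, 2, 3}"
    using assms(2) by (auto simp: complete_def)
  then have "1 \<in> snd ` X" "2 \<in> snd ` X" "3 \<in> snd ` X"
    by auto
  then obtain A B C where ABC: "(A, 1) \<in> X" "(B, 2) \<in> X" "(C, 3) \<in> X"
    by auto
  have "e \<in> {(A, 1), (B, 2), (C, 3)}" if "e \<in> X" for e
  proof -
    have "snd e \<in> {1, 2, 3}"
      using that colors by blast
    then show ?thesis
      using that ABC assms(1) unfolding selection_def inj_on_def by (metis insertCI insertE singletonD snd_conv)
  qed
  then have X_eq: "X = {(A, 1), (B, 2), (C, 3)}"
    using ABC by blast
  have "X \<subseteq> hedges H"
    using assms(1) by (simp add: selection_def)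
  then show thesis
    using ABC by (intro that[OF X_eq]; elim subsetD)
qed

lemma confusable_imp_cycle:
  assumes "confusable X Y"
  shows "has_three_colored_4_cycle H \<or> has_opposite_colored_6_cycle H \<or> has_rainbow_triangle H"
proof (cases "complete X")
  case True
  then have "complete Y"
    using assms by (simp add: confusable_def)
  have sel: "selection X" "selection Y"
    using assms by (simp_all add: confusable_def)
  obtain A B C where X: "X = {(A, 1), (B, 2), (C, 3)}"
      and ABC: "(A, 1) \<in> hedges H" "(B, 2) \<in> hedges H" "(C, 3) \<in> hedges H"
    using complete_selectionE[OF sel(1) True] .
  obtain D E F where Y: "Y = {(D, 1), (E, 2), (F, 3)}"
      and DEF: "(D, 1) \<in> hedges H" "(E, 2) \<in> hedges H" "(F, 3) \<in> hedges H"
    using complete_selectionE[OF sel(2) \<open>complete Y\<close>] .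
  have cover: "A \<union> B \<union> C = D \<union> E \<union> F"
  proof -
    have "\<Union> (fst ` X) = \<Union> (fst ` Y)"
      using assms by (simp add: confusable_def)
    then show ?thesis
      unfolding X Y by (simp add: Un_assoc)
  qed
  have no_star: "A \<inter> B \<inter> C = {}"
  proof -
    have "\<Inter> (fst ` X) = {}"
      using assms True by (simp add: confusable_def landmark_selection_def)
    then show ?thesis
      unfolding X by (simp add: Int_assoc)
  qed
  have "X \<noteq> Y"
    using assms by (simp add: confusable_def)
  then have "A \<noteq> D \<or> B \<noteq> E \<or> C \<noteq> F"
    unfolding X Y by blast
  then consider
      "A = D" "B = E" "C \<noteq> F" | "A = D" "B \<noteq> E" "C = F" | "A \<noteq> D" "B = E" "C = F"
    | "A = D" "B \<noteq> E" "C \<noteq> F" | "A \<noteq> D" "B = E" "C \<noteq> F" | "A \<noteq> D" "B \<noteq> E" "C = F"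
    | "A \<noteq> D" "B \<noteq> E" "C \<noteq> F"
    by metis
  then show ?thesis
  proof cases
    case 1
    moreover have "A \<union> B \<union> C = A \<union> B \<union> F"
      using cover 1 by blast
    ultimately show ?thesis
      using cover_differing_in_one_edge[of A 1 B 2 C 3 F] ABC DEF by simp
  next
    case 2
    moreover have "A \<union> C \<union> B = A \<union> C \<union> E"
      using cover 2 by blast
    ultimately show ?thesis
      using cover_differing_in_one_edge[of A 1 C 3 B 2 E] ABC DEF by simp
  next
    case 3
    moreover have "B \<union> C \<union> A = B \<union> C \<union> D"
      using cover 3 by blast
    ultimately show ?thesis
      using cover_differing_in_one_edge[of B 2 C 3 A 1 D] ABC DEF by simp
  next
    case 4
    moreover have "A \<union> B \<union> C = A \<union> E \<union> F"
      using cover 4 by blast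
    ultimately have "A \<inter> B \<inter> C \<noteq> {}"
      using cover_differing_in_two_edges[of A 1 B 2 E C 3 F] ABC DEF by simp
    then show ?thesis
      using no_star by blast
  next
    case 5
    moreover have "B \<union> A \<union> C = B \<union> D \<union> F"
      using cover 5 by blast
    ultimately have "B \<inter> A \<inter> C \<noteq> {}"
      using cover_differing_in_two_edges[of B 2 A 1 D C 3 F] ABC DEF by simp
    then show ?thesis
      using no_star by blast
  next
    case 6
    moreover have "C \<union> A \<union> B = C \<union> D \<union> E"
      using cover 6 by blast
    ultimately have "C \<inter> A \<inter> B \<noteq> {}"
      using cover_differing_in_two_edges[of C 3 A 1 D B 2 E] ABC DEF by simp
    then show ?thesis
      using no_star by blast
  next
    case 7
    then show ?thesis
      using cover_differing_in_three_edges[of A 1 D B 2 E C 3 F] ABC DEF cover by auto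
  qed
next
  case False
  then have inc: "selection X" "\<not> complete X" "X \<noteq> {}" "selection Y" "\<not> complete Y" "Y \<noteq> {}"
    and "X \<noteq> Y" and cover: "\<Union> (fst ` X) = \<Union> (fst ` Y)"
    using assms by (auto simp: confusable_def landmark_selection_def)
  obtain A a B b where X: "X = {(A, a), (B, b)}" "(A, a) \<in> hedges H" "(B, b) \<in> hedges H"
      "a = b \<Longrightarrow> A = B"
    using incomplete_selectionE[OF inc(1-3)] by blast
  obtain C c D d where Y: "Y = {(C, c), (D, d)}" "(C, c) \<in> hedges H" "(D, d) \<in> hedges H"
      "c = d \<Longrightarrow> C = D"
    using incomplete_selectionE[OF inc(4-6)] by blast
  have cover': "A \<union> B = C \<union> D"
    using cover X(1) Y(1) by simp
  have "has_rainbow_triangle H"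
  proof (rule ccontr)
    assume no_triangle: "\<not> has_rainbow_triangle H"
    have "X = Y"
      unfolding X(1) Y(1) by (rule two_edges_same_cover) (fact no_triangle X Y cover')+
    with \<open>X \<noteq> Y\<close> show False
      by simp
  qed
  then show ?thesis
    by simp
qed

text \<open>
  Any two of the three edges of a triangle cover all its vertices; leaving out a color makes the
  extra landmark agree with both selections.
\<close>

lemma rainbow_triangle_imp_confusable:
  assumes "has_rainbow_triangle H"
  shows "\<exists>X Y. confusable X Y"
proof -
  obtain p q r a b c where dist: "distinct [p, q, r]"
    and e: "({p, q}, a) \<in> hedges H" "({q, r}, b) \<in> hedges H" "({r, p}, c) \<in> hedges H"
    using assms unfolding rainbow_triangle_iff by blast
  have ne: "a \<noteq> b" "b \<noteq> c" "c \<noteq> a"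
    using dist e adjacent_edges_distinct_colors by (metis distinct_length_2_or_more)+
  have "card {i, j} \<noteq> card {1..3::nat}" for i j :: nat
    by (simp add: card_insert_if)
  then have inc: "{i, j} \<noteq> {1..3}" for i j :: nat
    by metis
  have "confusable {({p, q}, a), ({q, r}, b)} {({q, r}, b), ({r, p}, c)}"
    using dist e ne inc
    by (auto simp: confusable_def selection_def landmark_selection_def complete_def doubleton_eq_iff)
  then show ?thesis
    by blast
qed

text \<open>
  The two edges with unrepeated colors are opposite, so they already cover the cycle; adding either
  edge of the repeated color does not change the cover.
\<close>

lemma three_colored_4_cycle_imp_confusable:
  assumes "has_three_colored_4_cycle H"
  shows "\<exists>X Y. confusable X Y"
proof -
  obtain p q r s a b c where dist: "distinct [p, q, r, s]" "distinct [a, b, c]"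
    and e: "({p, q}, a) \<in> hedges H" "({q, r}, b) \<in> hedges H"
      "({r, s}, a) \<in> hedges H" "({s, p}, c) \<in> hedges H"
    using assms unfolding three_colored_4_cycle_iff by blast
  have colors: "{a, b, c} = {1..3}"
    using distinct_edge_colors e dist by blast
  have "({p, q}, a) \<notin> {({r, s}, a), ({q, r}, b), ({s, p}, c)}"
    using dist by (auto simp: doubleton_eq_iff)
  then have "{({p, q}, a), ({q, r}, b), ({s, p}, c)} \<noteq>
      {({r, s}, a), ({q, r}, b), ({s, p}, c)}"
    by (metis insertI1)
  then have "confusable {({p, q}, a), ({q, r}, b), ({s, p}, c)} {({r, s}, a), ({q, r}, b), ({s, p}, c)}"
    using dist e
    by (auto simp: confusable_def selection_def landmark_selection_def complete_def
        colors doubleton_eq_iff simp del: atLeastAtMost_iff)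
  then show ?thesis
    by blast
qed

text \<open>The two perfect matchings of the hexagon each contain all three colors.\<close>

lemma opposite_colored_6_cycle_imp_confusable:
  assumes "has_opposite_colored_6_cycle H"
  shows "\<exists>X Y. confusable X Y"
proof -
  obtain p q r s t u a b c where dist: "distinct [p, q, r, s, t, u]" "distinct [a, b, c]"
    and e: "({p, q}, a) \<in> hedges H" "({q, r}, b) \<in> hedges H" "({r, s}, c) \<in> hedges H"
      "({s, t}, a) \<in> hedges H" "({t, u}, b) \<in> hedges H" "({u, p}, c) \<in> hedges H"
    using assms unfolding opposite_colored_6_cycle_iff by blast
  have colors: "{a, b, c} = {1..3}"
    using distinct_edge_colors e dist by blast
  have "({p, q}, a) \<notin> {({s, t}, a), ({q, r}, b), ({u, p}, c)}"
    using dist by (auto simp: doubleton_eq_iff)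
  then have "{({p, q}, a), ({t, u}, b), ({r, s}, c)} \<noteq>
      {({s, t}, a), ({q, r}, b), ({u, p}, c)}"
    by (metis insertI1)
  then have "confusable {({p, q}, a), ({t, u}, b), ({r, s}, c)} {({s, t}, a), ({q, r}, b), ({u, p}, c)}"
    using dist e
    by (auto simp: confusable_def selection_def landmark_selection_def complete_def
        colors doubleton_eq_iff simp del: atLeastAtMost_iff)
  then show ?thesis
    by blast
qed

theorem ex_confusable_iff:
  "(\<exists>X Y. confusable X Y) \<longleftrightarrow>
     has_three_colored_4_cycle H \<or> has_opposite_colored_6_cycle H \<or> has_rainbow_triangle H"
  using confusable_imp_cycle rainbow_triangle_imp_confusable
    three_colored_4_cycle_imp_confusable opposite_colored_6_cycle_imp_confusable by metis

end

section \<open>Points as selections\<close>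

locale two_basic =
  fixes n :: nat and W :: "point set"
  assumes two_basic: "two_basic_landmark_system n W"
begin

lemma W_subset: "W \<subseteq> cube n"
  and slice_card: "i \<in> {1..3} \<Longrightarrow> a \<in> {1..n} \<Longrightarrow> card (coord_slice W i a) = 2"
  using two_basic by (auto simp: two_basic_landmark_system_def)

lemma slice_inter_card:
  assumes "i \<in> {1..3}" "j \<in> {1..3}" "i \<noteq> j" "a \<in> {1..n}" "b \<in> {1..n}"
  shows "card (coord_slice W i a \<inter> coord_slice W j b) \<le> 1"
  using assms two_basic unfolding two_basic_landmark_system_def
  by (metis Int_commute linorder_neqE_nat)

lemma slice_nonempty:
  assumes "i \<in> {1..3}" "a \<in> {1..n}"
  shows "coord_slice W i a \<noteq> {}"
  using slice_card[OF assms] by auto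

lemma hedges_iff:
  "(A, i) \<in> hedges (landmark_graph n W) \<longleftrightarrow>
     i \<in> {1..3} \<and> (\<exists>a \<in> {1..n}. A = coord_slice W i a)"
  using slice_nonempty by (auto simp: landmark_graph_def)

sublocale properly_colored_graph "landmark_graph n W"
proof
  fix A B i j
  assume A: "(A, i) \<in> hedges (landmark_graph n W)"
  then show "card A = 2" "A \<subseteq> hverts (landmark_graph n W)" "i \<in> {1..3}"
    by (auto simp: hedges_iff slice_card) (auto simp: landmark_graph_def coord_slice_def)
  show "A \<inter> B = {}" if "(B, i) \<in> hedges (landmark_graph n W)" "A \<noteq> B"
    using A that by (auto simp: hedges_iff coord_slice_def)
  show "i = j" if "(A, j) \<in> hedges (landmark_graph n W)"
  proof (rule ccontr)
    assume "i \<noteq> j"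
    then have "card (A \<inter> A) \<le> 1"
      using A that slice_inter_card unfolding hedges_iff by metis
    then show False
      using A slice_card by (auto simp: hedges_iff)
  qed
qed

text \<open>The value \<open>n + 1\<close> of a coordinate selects no edge of that color.\<close>

definition point_selection :: "point \<Rightarrow> (point set \<times> nat) set" where
  "point_selection x = {(coord_slice W i (coord i x), i) | i. i \<in> {1..3} \<and> coord i x \<le> n}"

lemma mem_point_selection:
  "(A, i) \<in> point_selection x \<longleftrightarrow> i \<in> {1..3} \<and> coord i x \<le> n \<and> A = coord_slice W i (coord i x)"
  by (auto simp: point_selection_def)

lemma coord_bounds: "x \<in> cube m \<Longrightarrow> i \<in> {1..3} \<Longrightarrow> 1 \<le> coord i x \<and> coord i x \<le> m"
  by (simp add: cube_iff)

lemma selection_point_selection: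
  assumes "x \<in> cube (n + 1)"
  shows "selection (point_selection x)"
  unfolding selection_def
proof
  show "inj_on snd (point_selection x)"
    by (auto simp: inj_on_def mem_point_selection)
  show "point_selection x \<subseteq> hedges (landmark_graph n W)"
  proof (rule subrelI)
    fix A i
    assume "(A, i) \<in> point_selection x"
    then show "(A, i) \<in> hedges (landmark_graph n W)"
      using coord_bounds[OF assms, of i] unfolding mem_point_selection hedges_iff
      by (intro conjI bexI[of _ "coord i x"]) auto
  qed
qed

lemma slice_eq_iff:
  assumes "i \<in> {1..3}" "a \<in> {1..n}"
  shows "coord_slice W i a = coord_slice W i b \<longleftrightarrow> a = b"
  using slice_nonempty[OF assms] by (auto simp: coord_slice_def)

lemma point_selection_inj:
  assumes "x \<in> cube (n + 1)" "y \<in> cube (n + 1)" "point_selection x = point_selection y"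
  shows "x = y"
  unfolding point_eq_iff
proof
  fix i :: nat
  assume i: "i \<in> {1..3}"
  have iff: "(A, i) \<in> point_selection x \<longleftrightarrow> (A, i) \<in> point_selection y" for A
    using assms(3) by simp
  show "coord i x = coord i y"
  proof (cases "coord i x \<le> n")
    case True
    then show ?thesis
      using iff[of "coord_slice W i (coord i x)"] i coord_bounds[OF assms(1) i] slice_eq_iff[OF i]
      by (auto simp: mem_point_selection)
  next
    case False
    then have "\<not> coord i y \<le> n"
      using iff[of "coord_slice W i (coord i y)"] i by (auto simp: mem_point_selection)
    then show ?thesis
      using False coord_bounds[OF assms(1) i] coord_bounds[OF assms(2) i] by simp
  qed
qed

lemma point_selection_surj:
  assumes "selection X"
  obtains x where "x \<in> cube (n + 1)" "point_selection x = X"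
proof -
  have X: "X \<subseteq> hedges (landmark_graph n W)" and inj: "inj_on snd X"
    using assms by (auto simp: selection_def)
  have "\<exists>a \<in> {1..n+1}. \<forall>A. (A, i) \<in> X \<longleftrightarrow> a \<le> n \<and> A = coord_slice W i a" for i
  proof (cases "\<exists>A. (A, i) \<in> X")
    case True
    then obtain A where A: "(A, i) \<in> X"
      by blast
    then obtain a where "a \<in> {1..n}" "A = coord_slice W i a"
      using X hedges_iff by blast
    moreover have "(B, i) \<in> X \<longleftrightarrow> B = A" for B
      using A inj by (metis inj_onD prod.inject snd_conv)
    ultimately show ?thesis
      by (intro bexI[of _ a]) auto
  next
    case False
    then show ?thesis
      by (intro bexI[of _ "n + 1"]) auto
  qed
  then obtain f where f: "\<And>i. f i \<in> {1..n+1}"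
      "\<And>i A. (A, i) \<in> X \<longleftrightarrow> f i \<le> n \<and> A = coord_slice W i (f i)"
    by metis
  obtain x where x: "\<And>i. i \<in> {1..3} \<Longrightarrow> coord i x = f i"
    using coord_tuple[of _ f] by blast
  have "x \<in> cube (n + 1)"
    using f(1) x by (simp only: cube_iff) simp
  moreover have "(A, i) \<in> point_selection x \<longleftrightarrow> (A, i) \<in> X" for A i
  proof (cases "i \<in> {1..3}")
    case True
    then show ?thesis
      unfolding mem_point_selection x[OF True] f(2) by simp
  next
    case False
    then show ?thesis
      using X edge_color unfolding mem_point_selection by blast
  qed
  then have "point_selection x = X"
    by (intro set_eqI) (metis surj_pair)
  ultimately show thesis
    using that by blast
qed

text \<open>
  Landmarks in \<open>W\<close> have coordinates at most \<open>n\<close>, so they cannot agree with \<open>x\<close> in a coordinate whose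
  edge is missing.
\<close>

lemma Union_point_selection:
  "\<Union> (fst ` point_selection x) = {w \<in> W. share_coord x w}"
proof (rule set_eqI)
  fix w
  have "w \<in> \<Union> (fst ` point_selection x) \<longleftrightarrow>
      (\<exists>i \<in> {1..3}. coord i x \<le> n \<and> w \<in> coord_slice W i (coord i x))"
    by (auto simp: point_selection_def)
  also have "\<dots> \<longleftrightarrow> w \<in> W \<and> share_coord x w"
  proof -
    have "coord i w \<le> n" if "w \<in> W" "i \<in> {1..3}" for i
      using that W_subset coord_bounds by blast
    then show ?thesis
      unfolding share_coord_def coord_slice_def mem_Collect_eq by metis
  qed
  finally show "w \<in> \<Union> (fst ` point_selection x) \<longleftrightarrow> w \<in> {w \<in> W. share_coord x w}"
    by simp
qed

lemma complete_point_selection: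
  "complete (point_selection x) \<longleftrightarrow> (\<forall>i \<in> {1..3}. coord i x \<le> n)"
proof -
  have "snd ` point_selection x = {i \<in> {1..3}. coord i x \<le> n}"
    by (force simp: point_selection_def)
  then show ?thesis
    unfolding complete_def by blast
qed

lemma share_coord_top_iff:
  assumes "x \<in> cube (n + 1)"
  shows "share_coord x (n + 1, n + 1, n + 1) \<longleftrightarrow> \<not> complete (point_selection x)"
proof -
  have "coord i (n + 1, n + 1, n + 1) = n + 1" for i
    by (simp add: coord_def)
  then show ?thesis
    using coord_bounds[OF assms] unfolding share_coord_def complete_point_selection
    by (metis Suc_eq_plus1 le_SucE not_less_eq_eq order_refl)
qed

text \<open>
  The edges of \<open>x\<close> have a common vertex \<open>w\<close> exactly if \<open>w\<close> agrees with \<open>x\<close> in every coordinate, that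
  is, if \<open>x = w\<close>.
\<close>

lemma landmark_point_selection:
  assumes "x \<in> cube (n + 1)"
  shows "landmark_selection (point_selection x) \<longleftrightarrow> x \<in> W \<union> {(n + 1, n + 1, n + 1)}"
proof -
  have "point_selection x = {} \<longleftrightarrow> (\<forall>i \<in> {1..3}. \<not> coord i x \<le> n)"
    by (auto simp: point_selection_def)
  also have "\<dots> \<longleftrightarrow> x = (n + 1, n + 1, n + 1)"
  proof -
    have "coord i (n + 1, n + 1, n + 1) = n + 1" for i
      by (simp add: coord_def)
    then show ?thesis
      unfolding point_eq_iff using coord_bounds[OF assms]
      by (metis Suc_eq_plus1 le_SucE not_less_eq_eq order_refl)
  qed
  finally have empty: "point_selection x = {} \<longleftrightarrow> x = (n + 1, n + 1, n + 1)" .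
  have "complete (point_selection x) \<and> \<Inter> (fst ` point_selection x) \<noteq> {} \<longleftrightarrow> x \<in> W"
  proof
    assume "x \<in> W"
    then have "\<forall>i \<in> {1..3}. coord i x \<le> n"
      using W_subset coord_bounds by blast
    moreover have "x \<in> \<Inter> (fst ` point_selection x)"
      using \<open>x \<in> W\<close> by (auto simp: point_selection_def coord_slice_def)
    ultimately show "complete (point_selection x) \<and> \<Inter> (fst ` point_selection x) \<noteq> {}"
      unfolding complete_point_selection by blast
  next
    assume *: "complete (point_selection x) \<and> \<Inter> (fst ` point_selection x) \<noteq> {}"
    then obtain w where w: "w \<in> \<Inter> (fst ` point_selection x)"
      by blast
    have "w \<in> coord_slice W i (coord i x)" if "i \<in> {1..3}" for i
    proof -
      have "(coord_slice W i (coord i x), i) \<in> point_selection x"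
        using that * by (simp add: mem_point_selection complete_point_selection)
      then show ?thesis
        using w by force
    qed
    then have w: "w \<in> W" "coord i x = coord i w" if "i \<in> {1..3}" for i
      using that by (auto simp: coord_slice_def)
    then have "x = w"
      by (simp add: point_eq_iff)
    then show "x \<in> W"
      using w(1)[of 1] by simp
  qed
  with empty show ?thesis
    by (auto simp: landmark_selection_def)
qed

end

section \<open>Resolving by triple-looped landmark systems\<close>

theorem theorem3p9:
  fixes n :: nat and W :: "point set" and u :: point
  assumes "n \<ge> 3"
    and "two_basic_landmark_system n W"
    and "u = (n + 1, n + 1, n + 1)"
  shows "resolving_set (with_proj (HG (n + 1))) (W \<union> {u}) \<longleftrightarrow>
    \<not> has_three_colored_4_cycle (landmark_graph n W) \<and>
    \<not> has_opposite_colored_6_cycle (landmark_graph n W) \<and>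
    \<not> has_rainbow_triangle (landmark_graph n W)"
proof -
  interpret two_basic n W
    by standard (fact assms(2))
  let ?S = "W \<union> {u}"
  let ?P = "cube (n + 1)"
  have "W \<subseteq> ?P" and "u \<in> ?P" and "u \<notin> W"
    using W_subset assms(3) by (auto simp: cube_def)
  have same_landmarks: "{w \<in> ?S. share_coord x w} = {w \<in> ?S. share_coord y w} \<longleftrightarrow>
      \<Union> (fst ` point_selection x) = \<Union> (fst ` point_selection y) \<and>
      (complete (point_selection x) \<longleftrightarrow> complete (point_selection y))"
    if "x \<in> ?P" "y \<in> ?P" for x y
    using share_coord_top_iff[OF that(1)] share_coord_top_iff[OF that(2)] \<open>u \<notin> W\<close> assms(3)
    unfolding Union_point_selection by blast
  have confusable_iff: "confusable (point_selection x) (point_selection y) \<longleftrightarrow>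
      x \<notin> ?S \<and> y \<notin> ?S \<and> x \<noteq> y \<and>
      {w \<in> ?S. share_coord x w} = {w \<in> ?S. share_coord y w}"
    if "x \<in> ?P" "y \<in> ?P" for x y
  proof -
    have "point_selection x = point_selection y \<longleftrightarrow> x = y"
      using point_selection_inj that by blast
    moreover have "selection (point_selection x)" "selection (point_selection y)"
      using selection_point_selection that by blast+
    moreover have "landmark_selection (point_selection x) \<longleftrightarrow> x \<in> ?S"
        "landmark_selection (point_selection y) \<longleftrightarrow> y \<in> ?S"
      unfolding assms(3) using landmark_point_selection that by blast+
    ultimately show ?thesis
      unfolding confusable_def same_landmarks[OF that] by metis
  qed
  have "resolving_set (with_proj (HG (n + 1))) ?S \<longleftrightarrow>
      (\<forall>x \<in> ?P - ?S. \<forall>y \<in> ?P - ?S.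
        {w \<in> ?S. share_coord x w} = {w \<in> ?S. share_coord y w} \<longrightarrow> x = y)"
    using \<open>n \<ge> 3\<close> \<open>W \<subseteq> ?P\<close> \<open>u \<in> ?P\<close> by (intro resolving_set_HG_iff) auto
  also have "\<dots> \<longleftrightarrow> \<not> (\<exists>x \<in> ?P. \<exists>y \<in> ?P. confusable (point_selection x) (point_selection y))"
    using confusable_iff by blast
  also have "\<dots> \<longleftrightarrow> \<not> (\<exists>X Y. confusable X Y)"
  proof -
    have "\<exists>x \<in> ?P. \<exists>y \<in> ?P. confusable (point_selection x) (point_selection y)"
      if conf: "confusable X Y" for X Y
    proof -
      have "selection X" "selection Y"
        using conf by (simp_all add: confusable_def)
      then obtain x y where "x \<in> ?P" "point_selection x = X" "y \<in> ?P" "point_selection y = Y"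
        by (elim point_selection_surj)
      with conf show ?thesis
        by blast
    qed
    then show ?thesis
      by blast
  qed
  finally show ?thesis
    unfolding ex_confusable_iff by blast
qed

end
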